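(* Let $A$ be a finite set of integers. If all elements of $A$ are odd, then $\sum A\equiv \sum A^{-1}\pmod 8$. Similarly, if none of the integers in $A$ is divisible by $3$, then $\sum A\equiv\sum A^{-1}\pmod 3$.
   Context: For a finite set $A=\{a_1,\ldots,a_r\}$ of non-zero integers, $\sum A$ denotes $a_1+\cdots+a_r$ and $\sum A^{-1}$ denotes the rational number $\frac1{a_1}+\cdots+\frac1{a_r}$. For rationals $x,y$ and a positive integer $M'$, $x\equiv y\pmod{M'}$ means that $x-y=u/v$ for some integers $u,v$ with $v\neq 0$, $\gcd(v,M')=1$ and $M'\mid u$. *)

theory Defs
  imports Complex_Main
begin

definition rat_cong :: "rat \<Rightarrow> rat \<Rightarrow> int \<Rightarrow> bool"
  where "rat_cong x y M \<longleftrightarrow>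
    (\<exists>u v :: int. v \<noteq> 0 \<and> gcd v M = 1 \<and> M dvd u \<and> x - y = of_int u / of_int v)"

definition recip_sum :: "int set \<Rightarrow> rat"
  where "recip_sum A = (\<Sum>a\<in>A. 1 / of_int a)"

end

theory Submission
  imports Defs
begin

text \<open>
  For each of the moduli \<open>M = 8\<close> and \<open>M = 3\<close>, every integer \<open>a\<close> coprime to \<open>M\<close> satisfies
  \<open>a\<^sup>2 \<equiv> 1 (mod M)\<close>, so \<open>a\<close> is its own inverse modulo \<open>M\<close>.  Concretely,
  \<open>a - 1/a = (a\<^sup>2 - 1)/a\<close> is a fraction whose numerator is divisible by \<open>M\<close> and whose
  denominator is coprime to \<open>M\<close>.  Congruence of rationals is compatible with addition, so
  these elementwise congruences add up over the whole set.
\<close>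

text \<open>A product of denominators coprime to \<open>M\<close> is again coprime to \<open>M\<close>, so fractions can
  be put over the product of their denominators.\<close>

lemma rat_cong_add:
  assumes "rat_cong x y M" "rat_cong x' y' M"
  shows "rat_cong (x + x') (y + y') M"
proof -
  obtain u v where uv: "v \<noteq> 0" "gcd v M = 1" "M dvd u" "x - y = of_int u / of_int v"
    using assms(1) unfolding rat_cong_def by (elim exE conjE)
  obtain u' v' where uv': "v' \<noteq> 0" "gcd v' M = 1" "M dvd u'" "x' - y' = of_int u' / of_int v'"
    using assms(2) unfolding rat_cong_def by (elim exE conjE)
  have "(x + x') - (y + y') = of_int u / of_int v + of_int u' / of_int v'"
    using uv(4) uv'(4) by simp
  also have "\<dots> = of_int (u * v' + u' * v) / of_int (v * v')"
    using uv(1) uv'(1) by (simp add: add_frac_eq)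
  finally have "(x + x') - (y + y') = of_int (u * v' + u' * v) / of_int (v * v')" .
  moreover have "gcd (v * v') M = 1"
    using uv(2) uv'(2) unfolding coprime_iff_gcd_eq_1[symmetric] by simp
  moreover have "M dvd u * v' + u' * v"
    using uv(3) uv'(3) by simp
  moreover have "v * v' \<noteq> 0"
    using uv(1) uv'(1) by simp
  ultimately show ?thesis
    unfolding rat_cong_def by (intro exI conjI)
qed

lemma rat_cong_sum:
  assumes "finite A" "\<And>a. a \<in> A \<Longrightarrow> rat_cong (f a) (g a) M"
  shows "rat_cong (sum f A) (sum g A) M"
  using assms
proof (induction A rule: finite_induct)
  case empty
  have "rat_cong 0 0 M"
    unfolding rat_cong_def by (rule exI[of _ 0], rule exI[of _ 1]) simp
  then show ?case by simp
next
  case (insert a A)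
  then show ?case by (simp add: rat_cong_add)
qed

text \<open>Coprimality of \<open>a\<close> and \<open>M\<close> comes for free: a common divisor divides both \<open>a\<^sup>2\<close> and
  \<open>a\<^sup>2 - 1\<close>.\<close>

lemma rat_cong_inverse_of_square_cong_1:
  fixes a M :: int
  assumes "a \<noteq> 0" "M dvd a^2 - 1"
  shows "rat_cong (of_int a) (1 / of_int a) M"
proof -
  have "coprime a M"
  proof (rule coprimeI)
    fix d assume "d dvd a" "d dvd M"
    have "d dvd a^2" using \<open>d dvd a\<close> by (simp add: power2_eq_square)
    moreover have "d dvd a^2 - 1" using \<open>d dvd M\<close> assms(2) by (rule dvd_trans)
    ultimately have "d dvd a^2 - (a^2 - 1)" by (rule dvd_diff)
    then show "is_unit d" by simp
  qed
  moreover have "of_int a - 1 / of_int a = (of_int (a^2 - 1) / of_int a :: rat)"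
    using assms(1) by (simp add: diff_divide_distrib power2_eq_square)
  ultimately show ?thesis
    using assms unfolding rat_cong_def coprime_iff_gcd_eq_1 by (intro exI conjI)
qed

lemma rat_cong_sum_recip_sum:
  assumes "finite A" "\<And>a. a \<in> A \<Longrightarrow> a \<noteq> 0" "\<And>a. a \<in> A \<Longrightarrow> M dvd a^2 - 1"
  shows "rat_cong (of_int (\<Sum>A)) (recip_sum A) M"
  unfolding recip_sum_def of_int_sum
  using assms by (intro rat_cong_sum rat_cong_inverse_of_square_cong_1) auto

text \<open>Writing \<open>a = 2 k + 1\<close>, the difference is \<open>4 k (k + 1)\<close>, and one of two consecutive
  integers is even.\<close>

lemma eight_dvd_odd_square_minus_1:
  fixes a :: int
  assumes "odd a"
  shows "8 dvd a^2 - 1"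
proof -
  obtain k where k: "a = 2 * k + 1" using assms by (rule oddE)
  have "even (k * (k + 1))" by simp
  then have "4 * 2 dvd 4 * (k * (k + 1))" by (intro mult_dvd_mono) auto
  also have "4 * (k * (k + 1)) = a^2 - 1"
    by (simp add: k power2_eq_square algebra_simps)
  finally show ?thesis by simp
qed

text \<open>One of the consecutive integers \<open>a - 1\<close>, \<open>a\<close>, \<open>a + 1\<close> is a multiple of \<open>3\<close>; if it
  is not \<open>a\<close>, then it is a factor of \<open>a\<^sup>2 - 1\<close>.\<close>

lemma three_dvd_square_minus_1:
  fixes a :: int
  assumes "\<not> 3 dvd a"
  shows "3 dvd a^2 - 1"
proof -
  have "3 dvd a - 1 \<or> 3 dvd a + 1" using assms by presburger
  then have "3 dvd (a - 1) * (a + 1)" by auto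
  also have "(a - 1) * (a + 1) = a^2 - 1"
    by (simp add: power2_eq_square algebra_simps)
  finally show ?thesis .
qed

theorem lemma1:
  fixes A :: "int set"
  assumes "finite A"
  shows "((\<forall>a\<in>A. odd a) \<longrightarrow> rat_cong (of_int (\<Sum>A)) (recip_sum A) 8) \<and>
         ((\<forall>a\<in>A. \<not> 3 dvd a) \<longrightarrow> rat_cong (of_int (\<Sum>A)) (recip_sum A) 3)"
proof (intro conjI impI)
  assume "\<forall>a\<in>A. odd a"
  then show "rat_cong (of_int (\<Sum>A)) (recip_sum A) 8"
    using assms by (intro rat_cong_sum_recip_sum eight_dvd_odd_square_minus_1) auto
next
  assume "\<forall>a\<in>A. \<not> 3 dvd a"
  then show "rat_cong (of_int (\<Sum>A)) (recip_sum A) 3"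
    using assms by (intro rat_cong_sum_recip_sum three_dvd_square_minus_1) auto
qed

end
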